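(* Let $q\ge2$ be an integer and consider the implicit Runge-Kutta method with real coefficients $\hat\alpha_1,\dots,\hat\alpha_q$, $\hat\beta_1,\dots,\hat\beta_{q-1}$, $\hat d_1,\dots,\hat d_{q-1}$ described in the context, with stability function $\hat R(z)=\hat P(z)/\hat Q(z)$, where $\hat Q(z)=\prod_{j=1}^{q-1}(1-z\hat d_j)$ and $\hat P(z)=1+\sum_{j=1}^q\hat\sigma_jz^j$ (with $\hat\sigma_j:=0$ for $j>q$). Suppose that $\hat Q(iy)\ne0$ for all $y\in\mathbb R$. Assume $\hat\sigma_4=\dots=\hat\sigma_q=0$ and let $$\gamma_1:=\hat\sigma_1^2-2\hat\sigma_2-\sum_{j=1}^{q-1}\hat d_j^2,\qquad \gamma_2:=\hat\sigma_2^2-2\hat\sigma_1\hat\sigma_3-\sum_{1\le j<k\le q-1}\hat d_j^2\hat d_k^2,$$ $$\gamma_3:=\hat\sigma_3^2-\sum_{1\le j<k<l\le q-1}\hat d_j^2\hat d_k^2\hat d_l^2.$$ If $\gamma_1,\gamma_2,\gamma_3\le0$, then the implicit method is I-stable. If in addition $\hat d_j\ge0$ for $j=1,\dots,q-1$, then the implicit method is A-stable.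
   Context: The implicit method. For an integer $q\ge2$ and real coefficients $\hat\alpha_1,\dots,\hat\alpha_q$, $\hat\beta_1,\dots,\hat\beta_{q-1}$, $\hat d_1,\dots,\hat d_{q-1}$, the implicit method is the $(q+1)$-stage Runge-Kutta method with Butcher matrix $\hat A\in\mathbb R^{(q+1)\times(q+1)}$ (rows and columns indexed $1,\dots,q+1$) given by $\hat A_{j+1,j}=\hat\alpha_j$ for $1\le j\le q$, $\hat A_{j+1,1}=\hat\beta_{j-1}$ for $2\le j\le q$, $\hat A_{j+1,j+1}=\hat d_j$ for $1\le j\le q-1$, and all other entries zero; its weights are $\hat b_j=\hat A_{q+1,j}$ for $1\le j\le q+1$, and $\hat c=\hat A\mathbf 1$ with $\mathbf 1=(1,\dots,1)^T$. Stability function. $\hat R(z)=1+z\,\hat b^T(I-z\hat A)^{-1}\mathbf 1$. It is written as $\hat R(z)=\hat P(z)/\hat Q(z)$ with $\hat Q(z)=\prod_{j=1}^{q-1}(1-z\hat d_j)$; then $\hat P=\hat R\hat Q$ is a polynomial of degree at most $q$ with $\hat P(0)=1$, and the real numbers $\hat\sigma_1,\dots,\hat\sigma_q$ are defined as its coefficients: $\hat P(z)=1+\sum_{j=1}^q\hat\sigma_jz^j$. Stability notions. The method is I-stable if $|\hat R(iy)|\le1$ for all $y\in\mathbb R$, and A-stable if $|\hat R(z)|\le1$ for all $z\in\mathbb C$ with $\operatorname{Re}z\le0$. *)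

theory Defs
  imports Complex_Main "HOL-Computational_Algebra.Polynomial"
    "Jordan_Normal_Form.Gauss_Jordan_Elimination"
begin

definition ones_vec :: "nat \<Rightarrow> 'a :: one vec" where
  "ones_vec n = vec n (\<lambda>_. 1)"

(* The inverse exists, and the value is meaningful, exactly where I - z A is nonsingular. *)
definition rk_stability_fun :: "real mat \<Rightarrow> real vec \<Rightarrow> complex \<Rightarrow> complex" where
  "rk_stability_fun A b z =
     1 + z * (map_vec complex_of_real b \<bullet>
       (the (mat_inverse (1\<^sub>m (dim_row A) - z \<cdot>\<^sub>m map_mat complex_of_real A))
          *\<^sub>v ones_vec (dim_row A)))"

definition rk_I_stable :: "real mat \<Rightarrow> real vec \<Rightarrow> bool" where
  "rk_I_stable A b \<longleftrightarrow> (\<forall>y :: real. cmod (rk_stability_fun A b (\<i> * complex_of_real y)) \<le> 1)"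

definition rk_A_stable :: "real mat \<Rightarrow> real vec \<Rightarrow> bool" where
  "rk_A_stable A b \<longleftrightarrow> (\<forall>z :: complex. Re z \<le> 0 \<longrightarrow> cmod (rk_stability_fun A b z) \<le> 1)"

(* The coefficients are indexed from 1 as in the mathematical text, matrix entries from 0:
   entry (r, c) here is the entry with 1-based indices r + 1, c + 1.  Only
   alpha_1, ..., alpha_q, beta_1, ..., beta_{q-1} and d_1, ..., d_{q-1} are used. *)
definition implicit_A ::
    "nat \<Rightarrow> (nat \<Rightarrow> real) \<Rightarrow> (nat \<Rightarrow> real) \<Rightarrow> (nat \<Rightarrow> real) \<Rightarrow> real mat" where
  "implicit_A q \<alpha> \<beta> d = mat (q + 1) (q + 1) (\<lambda>(r, c).
     if 1 \<le> r \<and> c = r - 1 then \<alpha> r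
     else if 2 \<le> r \<and> c = 0 then \<beta> (r - 1)
     else if 1 \<le> r \<and> r \<le> q - 1 \<and> c = r then d r
     else 0)"

definition implicit_b ::
    "nat \<Rightarrow> (nat \<Rightarrow> real) \<Rightarrow> (nat \<Rightarrow> real) \<Rightarrow> (nat \<Rightarrow> real) \<Rightarrow> real vec" where
  "implicit_b q \<alpha> \<beta> d = row (implicit_A q \<alpha> \<beta> d) q"

definition implicit_R ::
    "nat \<Rightarrow> (nat \<Rightarrow> real) \<Rightarrow> (nat \<Rightarrow> real) \<Rightarrow> (nat \<Rightarrow> real) \<Rightarrow> complex \<Rightarrow> complex" where
  "implicit_R q \<alpha> \<beta> d = rk_stability_fun (implicit_A q \<alpha> \<beta> d) (implicit_b q \<alpha> \<beta> d)"

definition implicit_Q :: "nat \<Rightarrow> (nat \<Rightarrow> real) \<Rightarrow> complex \<Rightarrow> complex" where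
  "implicit_Q q d z = (\<Prod>j = 1..q - 1. 1 - z * complex_of_real (d j))"

(* The polynomial P = R Q.  The zeros of Q are exactly the points where I - z A is singular. *)
definition implicit_P ::
    "nat \<Rightarrow> (nat \<Rightarrow> real) \<Rightarrow> (nat \<Rightarrow> real) \<Rightarrow> (nat \<Rightarrow> real) \<Rightarrow> real poly" where
  "implicit_P q \<alpha> \<beta> d = (THE p. \<forall>z. implicit_Q q d z \<noteq> 0 \<longrightarrow>
     poly (map_poly complex_of_real p) z = implicit_R q \<alpha> \<beta> d z * implicit_Q q d z)"

(* Since P has degree at most q, sigma_j = 0 for j > q. *)
definition implicit_sigma ::
    "nat \<Rightarrow> (nat \<Rightarrow> real) \<Rightarrow> (nat \<Rightarrow> real) \<Rightarrow> (nat \<Rightarrow> real) \<Rightarrow> nat \<Rightarrow> real" where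
  "implicit_sigma q \<alpha> \<beta> d j = coeff (implicit_P q \<alpha> \<beta> d) j"

end

theory Submission
  imports "HOL-Complex_Analysis.Conformal_Mappings" Defs "Jordan_Normal_Form.Char_Poly"
begin

text \<open>
  The stability function at \<open>z\<close> is the last stage value of the method applied to
  \<open>y' = z y\<close> with initial value 1 and step size 1. Since the Butcher matrix is lower triangular, the stages can be
  solved for one after the other, and clearing denominators in this recursion produces a real
  polynomial \<open>P\<close> with \<open>P(0) = 1\<close> and degree at most \<open>q\<close> such that \<open>R = P / Q\<close>
  (\<open>stability_fun_eq_stage_numerator\<close>, \<open>implicit_P_eq_stage_numerator\<close>).

  With \<open>\<sigma>\<^sub>4 = \<dots> = \<sigma>\<^sub>q = 0\<close>, \<open>P\<close> is a cubic, and \<open>|P(i y)|\<^sup>2\<close> is a cubic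
  in \<open>y\<^sup>2\<close> with coefficients \<open>1\<close>, \<open>\<sigma>\<^sub>1\<^sup>2 - 2 \<sigma>\<^sub>2\<close>,
  \<open>\<sigma>\<^sub>2\<^sup>2 - 2 \<sigma>\<^sub>1 \<sigma>\<^sub>3\<close> and \<open>\<sigma>\<^sub>3\<^sup>2\<close>. On the other side
  \<open>|Q(i y)|\<^sup>2\<close> is the product of the factors \<open>1 + y\<^sup>2 d\<^sub>j\<^sup>2\<close>, whose coefficients as a
  polynomial in \<open>y\<^sup>2\<close> are the elementary symmetric functions of the \<open>d\<^sub>j\<^sup>2\<close>. All of them are
  nonnegative, so cutting off after the third only decreases the value
  (\<open>prod_one_plus_ge_esym3\<close>). The conditions on the three \<open>\<gamma>\<close>s compare the remaining
  coefficients one by one, whence \<open>|P(i y)| \<le> |Q(i y)|\<close>, which is I-stability.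

  If moreover all \<open>d\<^sub>j\<close> are nonnegative, then \<open>|Q| \<ge> 1\<close> on the closed left half-plane, so that
  \<open>R\<close> has no pole there and grows at most like the polynomial \<open>P\<close>. The Phragmen-Lindelof
  principle (\<open>Phragmen_Lindelof_left_half_plane\<close>) extends the bound \<open>|R| \<le> 1\<close> from the
  imaginary axis to the half-plane; the ordinary maximum principle would first require control of
  \<open>R\<close> at infinity, hence a comparison of the degrees of \<open>P\<close> and \<open>Q\<close>.
\<close>

section \<open>Elementary symmetric sums and products\<close>

text \<open>
  Multiplying out and sorting the resulting products of \<open>x\<close>s by their least index. Applied
  repeatedly, this peels off the elementary symmetric sums written as nested sums over increasing
  indices.
\<close>
lemma prod_one_plus_by_least_index:
  fixes x :: "nat \<Rightarrow> 'a::comm_semiring_1"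
  shows "(\<Prod>j = a..m. 1 + x j) = 1 + (\<Sum>j = a..m. x j * (\<Prod>k = j + 1..m. 1 + x k))"
proof (induction "Suc m - a" arbitrary: a)
  case 0
  then show ?case by simp
next
  case (Suc n)
  then have "a \<le> m" by simp
  have "(\<Prod>j = a..m. 1 + x j) = (\<Prod>j = Suc a..m. 1 + x j) + x a * (\<Prod>j = Suc a..m. 1 + x j)"
    using \<open>a \<le> m\<close> by (simp add: prod.atLeast_Suc_atMost algebra_simps)
  also have "(\<Prod>j = Suc a..m. 1 + x j) + x a * (\<Prod>j = Suc a..m. 1 + x j)
    = 1 + (\<Sum>j = Suc a..m. x j * (\<Prod>k = j + 1..m. 1 + x k)) + x a * (\<Prod>j = Suc a..m. 1 + x j)"
    using Suc by (subst Suc(1)) auto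
  finally show ?case
    using \<open>a \<le> m\<close> by (simp add: sum.atLeast_Suc_atMost algebra_simps)
qed

text \<open>
  The left side consists of the terms of degree at most three in the expanded product; the omitted
  terms are products of nonnegative numbers.
\<close>
lemma prod_one_plus_ge_esym3:
  fixes x :: "nat \<Rightarrow> real"
  assumes "\<And>j. 0 \<le> x j"
  shows "1 + (\<Sum>j = a..m. x j) + (\<Sum>j = a..m. \<Sum>k = j + 1..m. x j * x k)
    + (\<Sum>j = a..m. \<Sum>k = j + 1..m. \<Sum>l = k + 1..m. x j * x k * x l) \<le> (\<Prod>j = a..m. 1 + x j)"
proof -
  note expand = prod_one_plus_by_least_index[of x]
  have ge1: "1 \<le> (\<Prod>j = b..m. 1 + x j)" for b
    by (rule prod_ge_1) (simp add: assms)
  have ge2: "1 + (\<Sum>j = b..m. x j) \<le> (\<Prod>j = b..m. 1 + x j)" for b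
    unfolding expand[of b] using mult_left_mono[OF ge1 assms]
    by (auto intro!: sum_mono)
  have ge3: "1 + (\<Sum>j = b..m. x j * (1 + (\<Sum>k = j + 1..m. x k))) \<le> (\<Prod>j = b..m. 1 + x j)" for b
    unfolding expand[of b] by (auto intro!: sum_mono mult_left_mono assms ge2)
  have "1 + (\<Sum>j = a..m. x j * (1 + (\<Sum>k = j + 1..m. x k * (1 + (\<Sum>l = k + 1..m. x l)))))
      \<le> (\<Prod>j = a..m. 1 + x j)"
    unfolding expand[of a] by (auto intro!: sum_mono mult_left_mono assms ge3[simplified])
  then show ?thesis
    by (simp add: algebra_simps sum.distrib sum_distrib_left)
qed

section \<open>The maximum principle on the left half-plane\<close>

text \<open>
  Dividing by a power of \<open>1 - e z\<close>, for small \<open>e > 0\<close>, beats the polynomial growth, and does not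
  increase the modulus on the imaginary axis because \<open>|1 - e z| \<ge> 1\<close> on the half-plane. The
  maximum principle on a large half-disc therefore gives \<open>|f w| \<le> |1 - e w| ^ (N + 1)\<close>, and then
  \<open>e\<close> tends to zero.
\<close>
lemma Phragmen_Lindelof_left_half_plane:
  fixes f :: "complex \<Rightarrow> complex"
  assumes hol: "f holomorphic_on {z. Re z < 0}" and cont: "continuous_on {z. Re z \<le> 0} f"
    and bdry: "\<And>z. Re z = 0 \<Longrightarrow> cmod (f z) \<le> 1"
    and growth: "\<And>z. Re z \<le> 0 \<Longrightarrow> cmod (f z) \<le> C * (1 + cmod z) ^ N"
    and w: "Re w \<le> 0"
  shows "cmod (f w) \<le> 1"
proof -
  have "cmod (f 0) \<le> C" using growth[of 0] by simp
  then have "0 \<le> C" using norm_ge_zero order_trans by blast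
  have damped: "cmod (f w) \<le> cmod (1 - of_real e * w) ^ Suc N" if e: "0 < e" "e \<le> 1" for e :: real
  proof -
    define h where "h = (\<lambda>z. 1 - complex_of_real e * z)"
    define g where "g = (\<lambda>z. f z / h z ^ Suc N)"
    have h1: "1 \<le> cmod (h z)" if "Re z \<le> 0" for z
    proof -
      have "1 \<le> Re (h z)" using that e by (simp add: h_def mult_nonneg_nonpos)
      then show ?thesis using complex_Re_le_cmod order_trans by blast
    qed
    then have h0: "h z \<noteq> 0" if "Re z \<le> 0" for z
      using that by force
    have h2: "e / 2 * (1 + cmod z) \<le> cmod (h z)" if "Re z \<le> 0" for z
    proof -
      have "(cmod (h z))\<^sup>2 = (e * cmod z)\<^sup>2 + (1 - 2 * (e * Re z))"
        unfolding power_mult_distrib cmod_power2 by (simp add: h_def power2_eq_square algebra_simps)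
      moreover have "e * Re z \<le> 0" using that e by (simp add: mult_nonneg_nonpos)
      ultimately have "(e * cmod z)\<^sup>2 \<le> (cmod (h z))\<^sup>2" by simp
      then have "e * cmod z \<le> cmod (h z)" by (rule power2_le_imp_le) simp
      with h1[OF that] e(2) show ?thesis by (simp add: algebra_simps)
    qed
    \<comment> \<open>On the arc the quotient is at most \<open>C (2 / e) ^ (N + 1) / (1 + r)\<close>, by \<open>h2\<close>.\<close>
    define r where "r = max (cmod w) (C * (2 / e) ^ Suc N)"
    have "0 \<le> r" by (simp add: r_def le_max_iff_disj)
    define S where "S = {z. Re z \<le> 0} \<inter> cball 0 r"
    have "closed S" unfolding S_def by (intro closed_Int closed_halfspace_Re_le closed_cball)
    have int: "interior S \<subseteq> {z. Re z < 0}"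
      using interior_halfspace_le[of "1::complex" 0] unfolding S_def by (simp add: subset_iff)
    have "cmod (g w) \<le> 1"
    proof (rule maximum_modulus_frontier[of g S])
      show "g holomorphic_on interior S"
        unfolding g_def using int h0
        by (intro holomorphic_intros holomorphic_on_subset[OF hol]) (auto simp: h_def intro!: holomorphic_intros)
      show "continuous_on (closure S) g"
        unfolding g_def closure_closed[OF \<open>closed S\<close>] using h0
        by (intro continuous_intros continuous_on_subset[OF cont]) (auto simp: h_def S_def intro!: continuous_intros)
      show "bounded S" unfolding S_def by (simp add: bounded_Int)
      show "w \<in> S" using w by (simp add: S_def r_def)
      fix z assume z: "z \<in> frontier S"
      then have "z \<in> S" using \<open>closed S\<close> frontier_subset_closed by blast
      then have "Re z \<le> 0" by (simp add: S_def)
      have hN: "1 \<le> cmod (h z) ^ Suc N" using h1[OF \<open>Re z \<le> 0\<close>] by (rule one_le_power)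
      consider "Re z = 0" | "cmod z = r"
      proof -
        have "z \<in> frontier {z. Re z \<le> 0} \<union> frontier (cball 0 r)"
          using z frontier_Int_subset unfolding S_def by blast
        then show ?thesis using that frontier_halfspace_le[of "1::complex" 0] by auto
      qed
      then have "cmod (f z) \<le> cmod (h z) ^ Suc N"
      proof cases
        case 1
        then show ?thesis using bdry hN by force
      next
        case 2
        have "C \<le> (e / 2) ^ Suc N * (1 + r)"
        proof -
          have "C * (2 / e) ^ Suc N \<le> 1 + r" by (simp add: r_def del: power_Suc)
          then show ?thesis using e by (simp add: field_simps del: power_Suc)
        qed
        have "cmod (f z) \<le> C * (1 + r) ^ N" using growth[OF \<open>Re z \<le> 0\<close>] 2 by simp
        also have "\<dots> \<le> (e / 2) ^ Suc N * (1 + r) * (1 + r) ^ N"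
          using \<open>C \<le> (e / 2) ^ Suc N * (1 + r)\<close> \<open>0 \<le> r\<close> by (intro mult_right_mono) auto
        also have "\<dots> = (e / 2 * (1 + cmod z)) ^ Suc N" using 2 by (simp add: power_mult_distrib power_divide)
        also have "\<dots> \<le> cmod (h z) ^ Suc N"
          using h2[OF \<open>Re z \<le> 0\<close>] e by (intro power_mono) auto
        finally show ?thesis .
      qed
      then show "cmod (g z) \<le> 1"
        using hN unfolding g_def norm_divide norm_power by (subst divide_le_eq_1_pos) auto
    qed
    then show ?thesis
      using h0[OF w] unfolding g_def norm_divide norm_power
      by (subst (asm) divide_le_eq_1_pos) (auto simp: h_def)
  qed
  have "((\<lambda>e. cmod (1 - of_real e * w) ^ Suc N) \<longlongrightarrow> cmod (1 - of_real 0 * w) ^ Suc N) (at_right (0::real))"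
    by (intro tendsto_intros)
  moreover have "\<forall>\<^sub>F e in at_right (0::real). cmod (f w) \<le> cmod (1 - of_real e * w) ^ Suc N"
    using eventually_at_right_real[of 0 1] by (rule eventually_mono) (use damped in auto)
  ultimately have "cmod (f w) \<le> cmod (1 - of_real 0 * w) ^ Suc N"
    by (rule tendsto_lowerbound) simp
  then show ?thesis by simp
qed

lemma cmod_poly_growth:
  "cmod (poly p z) \<le> (\<Sum>i\<le>degree p. cmod (coeff p i)) * (1 + cmod z) ^ degree p"
proof -
  have "cmod (coeff p i * z ^ i) \<le> cmod (coeff p i) * (1 + cmod z) ^ degree p" if "i \<le> degree p" for i
  proof -
    have "cmod z ^ i \<le> (1 + cmod z) ^ i" by (rule power_mono) auto
    also have "\<dots> \<le> (1 + cmod z) ^ degree p" using that by (rule power_increasing) auto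
    finally show ?thesis by (simp add: norm_mult norm_power mult_left_mono)
  qed
  then show ?thesis
    unfolding poly_altdef sum_distrib_right by (intro sum_norm_le) auto
qed

section \<open>The stability function as a quotient of polynomials\<close>

unbundle no vec_syntax

interpretation of_real_poly: map_poly_inj_idom_hom complex_of_real ..

text \<open>
  The numerator of stage \<open>r\<close> (counted from 0) when its denominator is the product of the factors
  \<open>1 - d\<^sub>j z\<close> with \<open>1 \<le> j \<le> r\<close>, or \<open>1 \<le> j \<le> q - 1\<close> for the last stage. The term with \<open>\<beta>\<close> is absent in stage 1, where the
  entry below the diagonal already lies in the first column. The numerator of stage \<open>r\<close> does not
  involve \<open>d\<^sub>r\<close>, so stage \<open>q\<close> refers only to \<open>d\<^sub>1, \<dots>, d\<^sub>q\<^sub>-\<^sub>1\<close>.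
\<close>
primrec stage_numerator ::
    "(nat \<Rightarrow> real) \<Rightarrow> (nat \<Rightarrow> real) \<Rightarrow> (nat \<Rightarrow> real) \<Rightarrow> nat \<Rightarrow> real poly" where
  "stage_numerator \<alpha> \<beta> d 0 = 1"
| "stage_numerator \<alpha> \<beta> d (Suc r) =
     [:0, \<alpha> (Suc r):] * stage_numerator \<alpha> \<beta> d r
     + [:1, if r = 0 then 0 else \<beta> r:] * (\<Prod>j = 1..r. [:1, - d j:])"

lemma poly_stage_denominator:
  "poly (map_poly complex_of_real (\<Prod>j = 1..r. [:1, - d j:])) z
     = (\<Prod>j = 1..r. 1 - z * complex_of_real (d j))"
  by (simp add: hom_distribs poly_prod)

lemma poly_stage_numerator_Suc:
  "poly (map_poly complex_of_real (stage_numerator \<alpha> \<beta> d (Suc r))) z =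
     z * of_real (\<alpha> (Suc r)) * poly (map_poly complex_of_real (stage_numerator \<alpha> \<beta> d r)) z
     + (1 + z * of_real (if r = 0 then 0 else \<beta> r)) * (\<Prod>j = 1..r. 1 - z * complex_of_real (d j))"
  unfolding stage_numerator.simps of_real_poly.hom_add of_real_poly.hom_mult poly_add poly_mult poly_stage_denominator
  by (simp add: of_real_hom.map_poly_pCons_hom algebra_simps)

lemma degree_stage_numerator: "degree (stage_numerator \<alpha> \<beta> d r) \<le> r"
proof (induction r)
  case (Suc r)
  have "degree (\<Prod>j = 1..r. [:1, - d j:]) \<le> (\<Sum>j = 1..r. degree [:1, - d j:])"
    using degree_prod_sum_le[of "{1..r}" "\<lambda>j. [:1, - d j:]"] by (simp add: o_def)
  also have "\<dots> \<le> (\<Sum>j = 1..r. 1)" by (rule sum_mono) simp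
  finally have "degree (\<Prod>j = 1..r. [:1, - d j:]) \<le> r" by simp
  then have "degree ([:1, if r = 0 then 0 else \<beta> r:] * (\<Prod>j = 1..r. [:1, - d j:])) \<le> 1 + r"
    by (intro order_trans[OF degree_mult_le] add_mono) auto
  moreover have "degree ([:0, \<alpha> (Suc r):] * stage_numerator \<alpha> \<beta> d r) \<le> 1 + r"
    using Suc by (intro order_trans[OF degree_mult_le] add_mono) auto
  ultimately show ?case by (simp only: stage_numerator.simps degree_add_le plus_1_eq_Suc)
qed simp

lemma coeff_0_stage_numerator: "coeff (stage_numerator \<alpha> \<beta> d r) 0 = 1"
  by (cases r) (simp_all add: poly_0_coeff_0[symmetric] poly_prod)

text \<open>
  For weights equal to row \<open>m\<close> of \<open>A\<close>, the formula for the output of a step coincides with the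
  equation of stage \<open>m\<close>, so the stability function is that stage value (with the last row: the
  method is stiffly accurate). The matrix \<open>I - z A\<close> is invertible because its determinant is the product of its
  diagonal entries.
\<close>
lemma rk_stages_exist:
  fixes A :: "real mat"
  assumes A: "A \<in> carrier_mat n n" and m: "m < n"
    and lower: "\<And>i j. i < j \<Longrightarrow> j < n \<Longrightarrow> A $$ (i, j) = 0"
    and diag: "\<And>i. i < n \<Longrightarrow> 1 - z * of_real (A $$ (i, i)) \<noteq> 0"
  shows "\<exists>y :: nat \<Rightarrow> complex. (\<forall>r<n. y r = 1 + z * (\<Sum>c<n. of_real (A $$ (r, c)) * y c))
    \<and> rk_stability_fun A (row A m) z = y m"
proof -
  let ?M = "1\<^sub>m n - z \<cdot>\<^sub>m map_mat complex_of_real A"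
  have M: "?M \<in> carrier_mat n n" using A by auto
  have "det ?M = prod_list (diag_mat ?M)"
    using A lower by (intro det_lower_triangular[OF _ M]) auto
  also have "\<dots> \<noteq> 0"
    using A diag by (auto simp: prod_list_zero_iff diag_mat_def)
  finally have "?M \<in> Units (ring_mat TYPE(complex) n ())"
    by (rule det_non_zero_imp_unit[OF M])
  then obtain B where inv: "mat_inverse ?M = Some B"
    using mat_inverse(1)[OF M, where b = "()"] by (cases "mat_inverse ?M") simp_all
  then have MB: "?M * B = 1\<^sub>m n" and B: "B \<in> carrier_mat n n"
    using mat_inverse(2)[OF M] by auto
  define v where "v = B *\<^sub>v ones_vec n"
  have ones: "ones_vec n \<in> carrier_vec n" by (simp add: ones_vec_def)
  have v: "v \<in> carrier_vec n" unfolding v_def using B ones by (rule mult_mat_vec_carrier)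
  have "?M *\<^sub>v v = ones_vec n"
    unfolding v_def assoc_mult_mat_vec[OF M B ones, symmetric] MB
    by (rule one_mult_mat_vec[OF ones])
  then have *: "v $ r = 1 + z * (\<Sum>c<n. of_real (A $$ (r, c)) * v $ c)" if "r < n" for r
  proof -
    have "1 = (?M *\<^sub>v v) $ r" using \<open>?M *\<^sub>v v = ones_vec n\<close> that by (simp add: ones_vec_def)
    also have "\<dots> = (\<Sum>c<n. ((if r = c then 1 else 0) - z * of_real (A $$ (r, c))) * v $ c)"
      using that A v by (auto simp: scalar_prod_def lessThan_atLeast0 intro!: sum.cong)
    also have "\<dots> = v $ r - z * (\<Sum>c<n. of_real (A $$ (r, c)) * v $ c)"
      using that by (simp add: left_diff_distrib sum_subtractf sum_distrib_left mult.assoc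
          if_distrib[of "\<lambda>x. x * _"] cong: if_cong)
    finally show ?thesis by (simp add: algebra_simps)
  qed
  have "rk_stability_fun A (row A m) z = 1 + z * (\<Sum>c<n. of_real (A $$ (m, c)) * v $ c)"
    using A v m inv by (auto simp: rk_stability_fun_def v_def[symmetric] scalar_prod_def lessThan_atLeast0 intro!: sum.cong)
  with *[OF m] have "rk_stability_fun A (row A m) z = v $ m" by simp
  with * show ?thesis by (intro exI[of _ "\<lambda>r. v $ r"] conjI allI impI)
qed

lemma implicit_A_row_sum:
  fixes y :: "nat \<Rightarrow> complex"
  assumes "s < q"
  shows "(\<Sum>c<q + 1. of_real (implicit_A q \<alpha> \<beta> d $$ (Suc s, c)) * y c) =
    of_real (\<alpha> (Suc s)) * y s + of_real (if s = 0 then 0 else \<beta> s) * y 0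
    + of_real (if Suc s \<le> q - 1 then d (Suc s) else 0) * y (Suc s)"
proof -
  have "(\<Sum>c<q + 1. of_real (implicit_A q \<alpha> \<beta> d $$ (Suc s, c)) * y c) =
    (\<Sum>c<q + 1. (if c = s then of_real (\<alpha> (Suc s)) * y c else 0)
      + (if c = 0 then of_real (if s = 0 then 0 else \<beta> s) * y c else 0)
      + (if c = Suc s then of_real (if Suc s \<le> q - 1 then d (Suc s) else 0) * y c else 0))"
    using assms by (intro sum.cong) (auto simp: implicit_A_def)
  then show ?thesis using assms by (simp add: sum.distrib)
qed

text \<open>
  Induction along the stages: multiplying the equation of stage \<open>r + 1\<close> by the denominator of
  stage \<open>r\<close> gives the recursion of the numerators.
\<close>
lemma stability_fun_eq_stage_numerator:
  assumes q: "1 \<le> q" and Q: "implicit_Q q d z \<noteq> 0"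
  shows "poly (map_poly complex_of_real (stage_numerator \<alpha> \<beta> d q)) z
    = implicit_R q \<alpha> \<beta> d z * implicit_Q q d z"
proof -
  let ?A = "implicit_A q \<alpha> \<beta> d"
  \<comment> \<open>The diagonal entry of the last stage is zero, so its denominator is that of stage \<open>q - 1\<close>.\<close>
  define e where "e j = (if j \<le> q - 1 then d j else 0)" for j
  define D where "D r = (\<Prod>j = 1..r. 1 - z * complex_of_real (e j))" for r
  have D: "D r = (\<Prod>j = 1..r. 1 - z * complex_of_real (d j))" if "r < q" for r
    using that unfolding D_def e_def by (intro prod.cong) auto
  have DQ: "D q = implicit_Q q d z"
    using q D[of "q - 1"] unfolding implicit_Q_def
    by (cases q) (auto simp: D_def e_def)
  have diag: "1 - z * of_real (?A $$ (i, i)) \<noteq> 0" if "i < q + 1" for i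
    using Q that by (auto simp: implicit_A_def implicit_Q_def)
  have carrier: "?A \<in> carrier_mat (q + 1) (q + 1)" by (simp add: implicit_A_def)
  have lower: "?A $$ (i, j) = 0" if "i < j" "j < q + 1" for i j
    using that by (auto simp: implicit_A_def)
  have "\<exists>y. (\<forall>r<q + 1. y r = 1 + z * (\<Sum>c<q + 1. of_real (?A $$ (r, c)) * y c))
      \<and> rk_stability_fun ?A (row ?A q) z = y q"
    by (rule rk_stages_exist[OF carrier less_add_one lower diag])
  then obtain y where y: "\<forall>r<q + 1. y r = 1 + z * (\<Sum>c<q + 1. of_real (?A $$ (r, c)) * y c)"
    and R: "rk_stability_fun ?A (row ?A q) z = y q"
    by (elim exE conjE) (rule that)
  have solve: "x * (1 - z * c) = 1 + z * a * u + z * b" if "x = 1 + z * (a * u + b + c * x)"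
    for x a b c u
  proof -
    have "x * (1 - z * c) - (1 + z * a * u + z * b) = x - (1 + z * (a * u + b + c * x))"
      by (simp add: algebra_simps)
    also have "\<dots> = 0" using that by (simp only: right_minus_eq)
    finally show ?thesis by (simp only: right_minus_eq)
  qed
  have y0: "y 0 = 1" using y[rule_format, of 0] by (simp add: implicit_A_def)
  have "poly (map_poly complex_of_real (stage_numerator \<alpha> \<beta> d r)) z = y r * D r" if "r \<le> q" for r
    using that
  proof (induction r)
    case 0
    then show ?case by (simp add: y0 D_def)
  next
    case (Suc r)
    have "r < q" "Suc r < q + 1" using Suc.prems by simp_all
    have "y (Suc r) = 1 + z * (\<Sum>c<q + 1. of_real (?A $$ (Suc r, c)) * y c)"
      by (rule y[rule_format]) fact
    also have "(\<Sum>c<q + 1. of_real (?A $$ (Suc r, c)) * y c) = of_real (\<alpha> (Suc r)) * y r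
        + of_real (if r = 0 then 0 else \<beta> r) * y 0 + of_real (e (Suc r)) * y (Suc r)"
      unfolding e_def by (rule implicit_A_row_sum) fact
    finally have "y (Suc r) = 1 + z * (of_real (\<alpha> (Suc r)) * y r
        + of_real (if r = 0 then 0 else \<beta> r) + of_real (e (Suc r)) * y (Suc r))"
      unfolding y0 mult_1_right .
    then have "y (Suc r) * (1 - z * of_real (e (Suc r)))
      = 1 + z * of_real (\<alpha> (Suc r)) * y r + z * of_real (if r = 0 then 0 else \<beta> r)"
      by (rule solve)
    moreover have "D (Suc r) = (1 - z * of_real (e (Suc r))) * D r" by (simp add: D_def)
    ultimately have "y (Suc r) * D (Suc r)
      = (1 + z * of_real (\<alpha> (Suc r)) * y r + z * of_real (if r = 0 then 0 else \<beta> r)) * D r"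
      by (simp only: mult.assoc[symmetric])
    moreover have "poly (map_poly complex_of_real (stage_numerator \<alpha> \<beta> d r)) z = y r * D r"
      using Suc by simp
    ultimately show ?case
      unfolding poly_stage_numerator_Suc D[OF \<open>r < q\<close>, symmetric] by (simp only: algebra_simps)
  qed
  then show ?thesis
    using R DQ by (simp add: implicit_R_def implicit_b_def)
qed

text \<open>
  The stages supply a polynomial with the defining property of \<open>implicit_P\<close>. For uniqueness, two
  such polynomials are compared after multiplication by \<open>Q\<close>, which makes them agree also at the
  zeros of \<open>Q\<close>.
\<close>
lemma implicit_P_eq_stage_numerator:
  assumes "1 \<le> q"
  shows "implicit_P q \<alpha> \<beta> d = stage_numerator \<alpha> \<beta> d q"
  unfolding implicit_P_def
proof (rule the_equality)
  show "\<forall>z. implicit_Q q d z \<noteq> 0 \<longrightarrow>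
     poly (map_poly complex_of_real (stage_numerator \<alpha> \<beta> d q)) z = implicit_R q \<alpha> \<beta> d z * implicit_Q q d z"
    using stability_fun_eq_stage_numerator[OF assms] by blast
next
  fix p assume p: "\<forall>z. implicit_Q q d z \<noteq> 0 \<longrightarrow>
     poly (map_poly complex_of_real p) z = implicit_R q \<alpha> \<beta> d z * implicit_Q q d z"
  let ?D = "\<Prod>j = 1..q - 1. [:1, - d j:]"
  have Q: "poly (map_poly complex_of_real ?D) z = implicit_Q q d z" for z
    unfolding implicit_Q_def by (rule poly_stage_denominator)
  have "poly (map_poly complex_of_real (p * ?D)) z = poly (map_poly complex_of_real (stage_numerator \<alpha> \<beta> d q * ?D)) z" for z
    unfolding of_real_poly.hom_mult poly_mult Q
    by (cases "implicit_Q q d z = 0") (simp_all add: p stability_fun_eq_stage_numerator[OF assms])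
  then have "poly (map_poly complex_of_real (p * ?D)) = poly (map_poly complex_of_real (stage_numerator \<alpha> \<beta> d q * ?D))"
    by (rule ext)
  then have "p * ?D = stage_numerator \<alpha> \<beta> d q * ?D"
    by (simp only: poly_eq_poly_eq_iff of_real_poly.eq_iff)
  moreover have "?D \<noteq> 0" by (simp add: prod_zero_iff)
  ultimately show "p = stage_numerator \<alpha> \<beta> d q" by simp
qed

section \<open>Moduli of numerator and denominator\<close>

lemma cmod_implicit_Q_imag:
  "(cmod (implicit_Q q d (\<i> * complex_of_real y)))\<^sup>2 = (\<Prod>j = 1..q - 1. 1 + y\<^sup>2 * (d j)\<^sup>2)"
  unfolding implicit_Q_def prod_norm[symmetric] prod_power_distrib
  by (simp add: cmod_power2 power_mult_distrib)

text \<open>For \<open>d\<^sub>j \<ge> 0\<close> the real part of each factor \<open>1 - z d\<^sub>j\<close> is already at least 1.\<close>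
lemma cmod_implicit_Q_ge_1:
  assumes "\<forall>j \<in> {1..q - 1}. 0 \<le> d j" "Re z \<le> 0"
  shows "1 \<le> cmod (implicit_Q q d z)"
  unfolding implicit_Q_def prod_norm[symmetric]
proof (rule prod_ge_1)
  fix j assume "j \<in> {1..q - 1}"
  then have "1 \<le> Re (1 - z * complex_of_real (d j))"
    using assms by (simp add: mult_nonpos_nonneg)
  then show "1 \<le> cmod (1 - z * complex_of_real (d j))"
    using complex_Re_le_cmod order_trans by blast
qed

text \<open>
  On the imaginary axis the even coefficients form the real part and the odd ones the imaginary part.
\<close>
lemma cmod_real_cubic_imag:
  assumes "degree p \<le> 3"
  shows "(cmod (poly (map_poly complex_of_real p) (\<i> * complex_of_real y)))\<^sup>2 =
    (coeff p 0)\<^sup>2 + ((coeff p 1)\<^sup>2 - 2 * coeff p 0 * coeff p 2) * y ^ 2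
    + ((coeff p 2)\<^sup>2 - 2 * coeff p 1 * coeff p 3) * y ^ 4 + (coeff p 3)\<^sup>2 * y ^ 6"
proof -
  have "p = [:coeff p 0, coeff p 1, coeff p 2, coeff p 3:]"
    using assms by (intro poly_eqI) (auto simp: coeff_pCons coeff_eq_0 numeral_eq_Suc split: nat.splits)
  then obtain a b c e where p: "p = [:a, b, c, e:]" by blast
  have P: "poly (map_poly complex_of_real p) (\<i> * complex_of_real y)
      = Complex (a - c * y\<^sup>2) (b * y - e * y ^ 3)"
    by (simp add: p of_real_hom.map_poly_pCons_hom complex_eq_iff power2_eq_square power3_eq_cube algebra_simps)
  show ?thesis
    unfolding P cmod_power2 by (simp add: p numeral_eq_Suc algebra_simps)
qed

section \<open>I-stability and A-stability\<close>

theorem theorem3p3: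
  fixes q :: nat and \<alpha> \<beta> d \<sigma> :: "nat \<Rightarrow> real" and \<gamma>1 \<gamma>2 \<gamma>3 :: real
  assumes "2 \<le> q"
    and "\<sigma> = implicit_sigma q \<alpha> \<beta> d"
    and "\<forall>y :: real. implicit_Q q d (\<i> * complex_of_real y) \<noteq> 0"
    and "\<forall>j \<in> {4..q}. \<sigma> j = 0"
    and "\<gamma>1 = (\<sigma> 1)^2 - 2 * \<sigma> 2 - (\<Sum>j = 1..q - 1. (d j)^2)"
    and "\<gamma>2 = (\<sigma> 2)^2 - 2 * \<sigma> 1 * \<sigma> 3
           - (\<Sum>j = 1..q - 1. \<Sum>k = j + 1..q - 1. (d j)^2 * (d k)^2)"
    and "\<gamma>3 = (\<sigma> 3)^2
           - (\<Sum>j = 1..q - 1. \<Sum>k = j + 1..q - 1. \<Sum>l = k + 1..q - 1.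
                (d j)^2 * (d k)^2 * (d l)^2)"
    and "\<gamma>1 \<le> 0" and "\<gamma>2 \<le> 0" and "\<gamma>3 \<le> 0"
  shows "rk_I_stable (implicit_A q \<alpha> \<beta> d) (implicit_b q \<alpha> \<beta> d) \<and>
    ((\<forall>j \<in> {1..q - 1}. 0 \<le> d j) \<longrightarrow>
      rk_A_stable (implicit_A q \<alpha> \<beta> d) (implicit_b q \<alpha> \<beta> d))"
proof -
  define p where "p = stage_numerator \<alpha> \<beta> d q"
  define P where "P = poly (map_poly complex_of_real p)"
  let ?Q = "implicit_Q q d"
  have "1 \<le> q" using \<open>2 \<le> q\<close> by simp
  have R: "implicit_R q \<alpha> \<beta> d z = P z / ?Q z" if "?Q z \<noteq> 0" for z
    using stability_fun_eq_stage_numerator[OF \<open>1 \<le> q\<close> that] that by (simp add: P_def p_def)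
  have \<sigma>: "\<sigma> j = coeff p j" for j
    using assms(2) by (simp add: implicit_sigma_def implicit_P_eq_stage_numerator[OF \<open>1 \<le> q\<close>] p_def)
  have "coeff p j = 0" if "3 < j" for j
  proof (cases "j \<le> q")
    case True
    then show ?thesis using assms(4) that \<sigma>[of j] by auto
  next
    case False
    then show ?thesis
      using degree_stage_numerator[of \<alpha> \<beta> d q] by (intro coeff_eq_0) (simp add: p_def)
  qed
  then have deg: "degree p \<le> 3" by (intro degree_le) auto
  have imag_axis: "cmod (P (\<i> * complex_of_real y)) \<le> cmod (?Q (\<i> * complex_of_real y))" for y
  proof -
    let ?x = "\<lambda>j. y\<^sup>2 * (d j)\<^sup>2"
    have "(cmod (P (\<i> * complex_of_real y)))\<^sup>2 = 1 + ((\<sigma> 1)\<^sup>2 - 2 * \<sigma> 2) * y ^ 2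
        + ((\<sigma> 2)\<^sup>2 - 2 * \<sigma> 1 * \<sigma> 3) * y ^ 4 + (\<sigma> 3)\<^sup>2 * y ^ 6"
      unfolding P_def cmod_real_cubic_imag[OF deg] \<sigma>
      by (simp add: p_def coeff_0_stage_numerator)
    also have "\<dots> \<le> 1 + (\<Sum>j = 1..q - 1. (d j)^2) * y ^ 2
        + (\<Sum>j = 1..q - 1. \<Sum>k = j + 1..q - 1. (d j)^2 * (d k)^2) * y ^ 4
        + (\<Sum>j = 1..q - 1. \<Sum>k = j + 1..q - 1. \<Sum>l = k + 1..q - 1. (d j)^2 * (d k)^2 * (d l)^2) * y ^ 6"
      using assms(5-10) by (intro add_mono mult_right_mono order_refl) auto
    also have "\<dots> = 1 + (\<Sum>j = 1..q - 1. ?x j) + (\<Sum>j = 1..q - 1. \<Sum>k = j + 1..q - 1. ?x j * ?x k)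
        + (\<Sum>j = 1..q - 1. \<Sum>k = j + 1..q - 1. \<Sum>l = k + 1..q - 1. ?x j * ?x k * ?x l)"
      unfolding sum_distrib_right
      by (intro arg_cong2[of _ _ _ _ "(+)"] sum.cong refl) (simp_all add: power2_eq_square eval_nat_numeral)
    also have "\<dots> \<le> (\<Prod>j = 1..q - 1. 1 + ?x j)"
      by (rule prod_one_plus_ge_esym3) simp
    also have "\<dots> = (cmod (?Q (\<i> * complex_of_real y)))\<^sup>2"
      by (simp only: cmod_implicit_Q_imag)
    finally show ?thesis by (rule power2_le_imp_le) simp
  qed
  have I: "cmod (implicit_R q \<alpha> \<beta> d (\<i> * complex_of_real y)) \<le> 1" for y
    using imag_axis[of y] assms(3) by (simp add: R norm_divide)
  have A: "cmod (implicit_R q \<alpha> \<beta> d z) \<le> 1"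
    if d: "\<forall>j \<in> {1..q - 1}. 0 \<le> d j" and z: "Re z \<le> 0" for z
  proof -
    have Q1: "1 \<le> cmod (?Q z)" if "Re z \<le> 0" for z
      using cmod_implicit_Q_ge_1[OF d that] .
    then have Q0: "?Q z \<noteq> 0" if "Re z \<le> 0" for z
      using that by force
    have hol: "?Q holomorphic_on S" "P holomorphic_on S" for S
      unfolding implicit_Q_def P_def by (intro holomorphic_intros)+
    let ?c = "map_poly complex_of_real p"
    have "cmod (P z / ?Q z) \<le> 1"
    proof (rule Phragmen_Lindelof_left_half_plane[where f = "\<lambda>z. P z / ?Q z" and N = "degree ?c"
          and C = "\<Sum>i\<le>degree ?c. cmod (coeff ?c i)"])
      show "(\<lambda>z. P z / ?Q z) holomorphic_on {z. Re z < 0}"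
        using Q0 by (intro holomorphic_on_divide hol) auto
      show "continuous_on {z. Re z \<le> 0} (\<lambda>z. P z / ?Q z)"
        using Q0 by (intro continuous_on_divide holomorphic_on_imp_continuous_on hol) auto
      show "Re z \<le> 0" by (rule z)
      fix u :: complex
      show "cmod (P u / ?Q u) \<le> 1" if "Re u = 0"
      proof -
        have "u = \<i> * complex_of_real (Im u)" using that by (simp add: complex_eq_iff)
        then have "cmod (P u) \<le> cmod (?Q u)" using imag_axis[of "Im u"] by simp
        then show ?thesis using Q0[of u] that by (simp add: norm_divide)
      qed
      show "cmod (P u / ?Q u) \<le> (\<Sum>i\<le>degree ?c. cmod (coeff ?c i)) * (1 + cmod u) ^ degree ?c" if "Re u \<le> 0"
      proof -
        have "cmod (P u / ?Q u) \<le> cmod (P u)"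
          using Q1[OF that] by (simp add: norm_divide divide_le_eq mult_le_cancel_left1)
        also note cmod_poly_growth[of ?c u, folded P_def]
        finally show ?thesis .
      qed
    qed
    then show ?thesis using R Q0[OF z] by simp
  qed
  show ?thesis
    using I A unfolding rk_I_stable_def rk_A_stable_def implicit_R_def by blast
qed
end
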